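(* There is a universal constant $c>0$ such that the following holds. For any integer $T>c$ and integers $n,d$ with $d>cT$ and $n>cT^2\log(T)$, for every deterministic algorithm that interacts for $T$ rounds with the two-sided oracle and then outputs $\mathbf{w}_{T+1}\in\mathbb{R}^d$, there exists a matrix $A\in[-1,+1]^{n\times d}$ satisfying \[ \max_{\mathbf{w}\in\mathbb{R}^d:\|\mathbf{w}\|_1\le1}\ \min_{\mathbf{p}\in\Delta^{n-1}}\mathbf{p}^\top A\mathbf{w}\ \ge\ \frac{1}{c\log(d)\sqrt{\log(n)}}\cdot\frac{1}{T^2\sqrt{T}}, \] yet the algorithm's output after $T$ rounds of interaction with $\mathcal{O}_2^A$ satisfies $\min_{\mathbf{p}\in\Delta^{n-1}}\mathbf{p}^\top A\mathbf{w}_{T+1}\le0$.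
   Context: $\Delta^{n-1}$ is the probability simplex in $\mathbb{R}^n$; $\log$ is the natural logarithm. The two-sided oracle $\mathcal{O}_2^A$: given $(\mathbf{p},\mathbf{w})\in\mathbb{R}^n\times\mathbb{R}^d$ (arbitrary vectors), returns $A\mathbf{w}$ and $\mathbf{p}^\top A$. A deterministic algorithm chooses its query $(\mathbf{p}_t,\mathbf{w}_t)$ at round $t$ as a deterministic function of responses from rounds $1,\dots,t-1$, and after round $T$ outputs $\mathbf{w}_{T+1}\in\mathbb{R}^d$ as a deterministic function of all responses. *)

theory Defs
  imports Complex_Main
begin

text \<open>Vectors in R^n / R^d are functions nat => real (only indices < n resp. < d matter);
  an n x d matrix is a function nat => nat => real (entries with i < n, j < d).\<close>

type_synonym vec = "nat \<Rightarrow> real"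
type_synonym mat = "nat \<Rightarrow> nat \<Rightarrow> real"

definition mat_vec :: "nat \<Rightarrow> nat \<Rightarrow> mat \<Rightarrow> vec \<Rightarrow> vec" where
  "mat_vec n d A w = (\<lambda>i. if i < n then (\<Sum>j<d. A i j * w j) else 0)"

definition vec_mat :: "nat \<Rightarrow> nat \<Rightarrow> vec \<Rightarrow> mat \<Rightarrow> vec" where
  "vec_mat n d p A = (\<lambda>j. if j < d then (\<Sum>i<n. p i * A i j) else 0)"

definition bilin :: "nat \<Rightarrow> nat \<Rightarrow> vec \<Rightarrow> mat \<Rightarrow> vec \<Rightarrow> real" where
  "bilin n d p A w = (\<Sum>i<n. \<Sum>j<d. p i * A i j * w j)"

definition simplex :: "nat \<Rightarrow> vec set" where
  "simplex n = {p. (\<forall>i<n. 0 \<le> p i) \<and> (\<Sum>i<n. p i) = 1 \<and> (\<forall>i\<ge>n. p i = 0)}"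

definition l1_ball :: "nat \<Rightarrow> vec set" where
  "l1_ball d = {w. (\<Sum>j<d. \<bar>w j\<bar>) \<le> 1 \<and> (\<forall>j\<ge>d. w j = 0)}"

definition margin :: "nat \<Rightarrow> nat \<Rightarrow> mat \<Rightarrow> vec \<Rightarrow> real" where
  "margin n d A w = Inf ((\<lambda>p. bilin n d p A w) ` simplex n)"

definition opt_margin :: "nat \<Rightarrow> nat \<Rightarrow> mat \<Rightarrow> real" where
  "opt_margin n d A = Sup (margin n d A ` l1_ball d)"

text \<open>A deterministic algorithm: the query at round t+1 is a function of the list of the
  t previous responses (A w_s, p_s^T A); the output is a function of all T responses.\<close>
type_synonym response = "vec \<times> vec"

fun history :: "(response list \<Rightarrow> vec \<times> vec) \<Rightarrow> nat \<Rightarrow> nat \<Rightarrow> mat \<Rightarrow> nat \<Rightarrow> response list" where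
  "history query n d A 0 = []"
| "history query n d A (Suc t) =
     (let h = history query n d A t; (p, w) = query h
      in h @ [(mat_vec n d A w, vec_mat n d p A)])"

end

theory Submission
  imports Defs "HOL-Analysis.Convex"
begin

text \<open>
  The adversary answers according to the chain
  \<open>A = \<Sum>k<T. (h\<^sub>k - h\<^sub>k\<^sub>+\<^sub>1) g\<^sub>k\<^sup>T + h\<^sub>T g\<^sub>T\<^sup>T\<close>, where \<open>h\<^sub>0\<close> is a multiple of the all-ones vector and the
  \<open>h\<^sub>k\<close> and the \<open>g\<^sub>k\<close> are orthogonal families. The vectors \<open>h\<^sub>k\<^sub>+\<^sub>1\<close> and \<open>g\<^sub>k\<close> are chosen in round
  \<open>k + 1\<close>, orthogonal to all queries made so far, so every round exposes only one more link. The last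
  \<open>g\<^sub>T\<close> is chosen orthogonal to the output as well.

  The sum telescopes: \<open>w = \<theta> \<Sum>k\<le>T. g\<^sub>k / \<bar>g\<^sub>k\<bar>\<^sup>2\<close> gives \<open>A w = \<theta> h\<^sub>0\<close>, a constant positive
  vector. On the other hand a suitable combination \<open>q \<ge> 0\<close> of the \<open>h\<^sub>k\<close> has the same inner product with
  every \<open>h\<^sub>k\<close>, so \<open>q\<^sup>T A\<close> is a multiple of \<open>g\<^sub>T\<close> and annihilates the output.

  Choosing the vectors in \<open>[-1, 1]\<^sup>n\<close> with squared norm at least \<open>n / 2\<close> keeps the entries of \<open>A\<close>
  bounded by \<open>1\<close> for \<open>\<bar>h\<^sub>k\<bar> = O(1 / T)\<close> entrywise. As \<open>q \<ge> 0\<close> forces \<open>h\<^sub>0\<close> to be smaller than the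
  other \<open>h\<^sub>k\<close> by a factor \<open>T\<close>, and Cauchy-Schwarz bounds the 1-norm of \<open>w\<close> by \<open>2 \<theta> \<surd>T\<close>, the margin is of
  order \<open>1 / (T\<^sup>2 \<surd>T)\<close>.
\<close>

section \<open>Vectors orthogonal to finitely many given vectors\<close>

definition dot :: "nat \<Rightarrow> vec \<Rightarrow> vec \<Rightarrow> real" where
  "dot n x y = (\<Sum>i<n. x i * y i)"

lemma dot_commute: "dot n x y = dot n y x"
  by (simp add: dot_def mult.commute)

lemma dot_scale_right: "dot n u (\<lambda>i. a * x i) = a * dot n u x"
  by (simp add: dot_def sum_distrib_left mult.left_commute)

lemma dot_add_scaled_right: "dot n u (\<lambda>i. a * x i + b * y i) = a * dot n u x + b * dot n u y"
  by (simp add: dot_def sum.distrib sum_distrib_left algebra_simps)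

lemma dot_sum_right: "dot n u (\<lambda>i. \<Sum>k\<in>K. c k * x k i) = (\<Sum>k\<in>K. c k * dot n u (x k))"
  unfolding dot_def sum_distrib_left
  by (subst sum.swap) (simp add: mult.left_commute)

text \<open>A homogeneous linear system with more unknowns than equations. To add the equation of
  \<open>v\<close>, take a solution \<open>x\<close> for \<open>U\<close> with \<open>x j\<close>
  nonzero and a second one \<open>y\<close> that avoids the coordinate \<open>j\<close>. Unless
  \<open>y\<close> already satisfies the new equation, eliminating \<open>v\<close> between the two
  leaves a vector that is nonzero at \<open>j\<close>.\<close>

lemma exists_nonzero_orthogonal:
  assumes "finite U" "finite S" "card U < card S" "S \<subseteq> {..<n}"
  shows "\<exists>x. (\<forall>i. i \<notin> S \<longrightarrow> x i = 0) \<and> (\<exists>i\<in>S. x i \<noteq> 0) \<and> (\<forall>u\<in>U. dot n u x = 0)"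
  using assms
proof (induction U arbitrary: S rule: finite_induct)
  case empty
  then obtain s where "s \<in> S" by fastforce
  then show ?case by (intro exI[of _ "\<lambda>i. if i = s then 1 else 0"]) auto
next
  case (insert v U)
  from insert.prems insert.hyps obtain s where s: "s \<in> S" by fastforce
  have drop: "\<exists>x. (\<forall>i. i \<notin> S - {s} \<longrightarrow> x i = 0) \<and> (\<exists>i\<in>S - {s}. x i \<noteq> 0) \<and> (\<forall>u\<in>U. dot n u x = 0)"
    if "s \<in> S" for s
    using that insert.prems insert.hyps by (intro insert.IH) auto
  from drop[OF s] obtain x j where x: "\<forall>i. i \<notin> S \<longrightarrow> x i = 0" "j \<in> S" "x j \<noteq> 0"
    "\<forall>u\<in>U. dot n u x = 0" by blast
  from drop[OF x(2)] obtain y where y: "\<forall>i. i \<notin> S \<longrightarrow> y i = 0" "y j = 0" "\<exists>i\<in>S. y i \<noteq> 0"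
    "\<forall>u\<in>U. dot n u y = 0" by blast
  show ?case
  proof (cases "dot n v y = 0")
    case True
    then show ?thesis using y by auto
  next
    case False
    let ?z = "\<lambda>i. dot n v y * x i + (- dot n v x) * y i"
    have "?z j \<noteq> 0" using False x y by simp
    moreover have "\<forall>u\<in>insert v U. dot n u ?z = 0"
      using x(4) y(4) by (auto simp only: dot_add_scaled_right) (simp_all add: mult.commute)
    moreover have "\<forall>i. i \<notin> S \<longrightarrow> ?z i = 0" using x(1) y(1) by simp
    ultimately show ?thesis using x(2) by (intro exI[of _ ?z] conjI bexI[of _ j])
  qed
qed

text \<open>An extreme point of the cube intersected with a subspace of codimension \<open>m\<close> has at most
  \<open>m\<close> coordinates off \<open>\<plusminus>1\<close>; such a point is reached by repeatedly moving along the subspace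
  until one more coordinate saturates.\<close>

lemma exists_saturated_orthogonal:
  assumes U: "finite U" and k: "k + card U \<le> n"
  shows "\<exists>x. (\<forall>i<n. \<bar>x i\<bar> \<le> 1) \<and> k \<le> card {i. i < n \<and> \<bar>x i\<bar> = 1} \<and> (\<forall>u\<in>U. dot n u x = 0)"
  using k
proof (induction k)
  case 0
  show ?case by (intro exI[of _ "\<lambda>_. 0"]) (auto simp: dot_def)
next
  case (Suc k)
  then obtain x where x: "\<forall>i<n. \<bar>x i\<bar> \<le> 1" "k \<le> card {i. i < n \<and> \<bar>x i\<bar> = 1}"
    "\<forall>u\<in>U. dot n u x = 0" by auto
  define F where "F = {i. i < n \<and> \<bar>x i\<bar> = 1}"
  define S where "S = {..<n} - F"
  show ?case
  proof (cases "Suc k \<le> card F")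
    case True
    then show ?thesis using x unfolding F_def by blast
  next
    case False
    have "card S = n - card F" unfolding S_def by (subst card_Diff_subset) (auto simp: F_def)
    then have "card U < card S" using False Suc.prems x(2) by simp
    with exists_nonzero_orthogonal[OF U, of S n] obtain y where
      y: "\<forall>i. i \<notin> S \<longrightarrow> y i = 0" "\<exists>i\<in>S. y i \<noteq> 0" "\<forall>u\<in>U. dot n u y = 0"
      by (auto simp: S_def)
    define R where "R = {i \<in> S. y i \<noteq> 0}"
    \<comment> \<open>Moving from \<open>x\<close> along \<open>y\<close>, coordinate
      \<open>i\<close> reaches the face of the cube it is heading for at time
      \<open>\<tau> i\<close>. Stopping at the first such time stays in the cube and saturates one
      more coordinate; those in \<open>F\<close> stay put because \<open>y\<close> vanishes
      there.\<close>
    define \<tau> where "\<tau> = (\<lambda>i. (sgn (y i) - x i) / y i)"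
    define t where "t = Min (\<tau> ` R)"
    have R: "finite R" "R \<noteq> {}" using y(2) by (auto simp: R_def S_def)
    have Sx: "\<bar>x i\<bar> < 1" if "i \<in> S" for i
      using that x(1) by (force simp: S_def F_def)
    have \<tau>pos: "0 < \<tau> i" if "i \<in> R" for i
      using Sx[of i] that by (auto simp: R_def \<tau>_def sgn_if zero_less_divide_iff)
    have t: "t \<in> \<tau> ` R" unfolding t_def using R by (intro Min_in) auto
    then have tpos: "0 < t" using \<tau>pos by auto
    have tle: "t \<le> \<tau> i" if "i \<in> R" for i unfolding t_def using R that by simp
    \<comment> \<open>The factor \<open>1\<close> gives \<open>z\<close> the shape of
      \<open>dot_add_scaled_right\<close>.\<close>
    define z where "z = (\<lambda>i. 1 * x i + t * y i)"
    have zbound: "\<bar>z i\<bar> \<le> 1" if "i < n" for i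
    proof (cases "i \<in> R")
      case True
      then have xi: "\<bar>x i\<bar> < 1" and yi: "y i \<noteq> 0" using Sx by (auto simp: R_def)
      show ?thesis
      proof (cases "y i > 0")
        case True
        then have "t * y i \<le> 1 - x i" using tle[OF \<open>i \<in> R\<close>] by (simp add: \<tau>_def field_simps)
        moreover have "0 \<le> t * y i" using True tpos by simp
        ultimately show ?thesis using xi unfolding z_def by linarith
      next
        case False
        with yi have neg: "y i < 0" by simp
        then have "t * y i \<ge> - 1 - x i" using tle[OF \<open>i \<in> R\<close>] by (simp add: \<tau>_def field_simps)
        moreover have "t * y i \<le> 0" using neg tpos by (simp add: mult_nonneg_nonpos)
        ultimately show ?thesis using xi unfolding z_def by linarith
      qed
    next
      case False
      then have "y i = 0" using y(1) by (auto simp: R_def)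
      then show ?thesis using x(1) that by (simp add: z_def)
    qed
    from t obtain j where j: "j \<in> R" "t = \<tau> j" by auto
    then have "z j = sgn (y j)" by (auto simp: z_def \<tau>_def R_def)
    then have zj: "\<bar>z j\<bar> = 1" "j < n" "j \<notin> F" using j by (auto simp: R_def S_def abs_sgn_eq)
    have "insert j F \<subseteq> {i. i < n \<and> \<bar>z i\<bar> = 1}"
      using zj y(1) by (auto simp: F_def S_def z_def)
    then have "card (insert j F) \<le> card {i. i < n \<and> \<bar>z i\<bar> = 1}"
      by (intro card_mono) auto
    then have "Suc k \<le> card {i. i < n \<and> \<bar>z i\<bar> = 1}"
      using zj(3) x(2) by (simp add: F_def)
    moreover have "\<forall>u\<in>U. dot n u z = 0"
      using x(3) y(3) unfolding z_def by (simp only: dot_add_scaled_right) simp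
    ultimately show ?thesis using zbound by blast
  qed
qed

text \<open>At least \<open>n - card U\<close>, hence at least half, of the coordinates can be made
  1 or -1, and each of them adds 1 to the squared norm.\<close>

lemma exists_spread_orthogonal:
  assumes U: "finite U" and k: "2 * card U \<le> n"
  shows "\<exists>x. (\<forall>i<n. \<bar>x i\<bar> \<le> 1) \<and> real n / 2 \<le> dot n x x \<and> (\<forall>u\<in>U. dot n u x = 0)"
proof -
  have "n - card U + card U \<le> n" using k by simp
  from exists_saturated_orthogonal[OF U this] obtain x where x: "\<forall>i<n. \<bar>x i\<bar> \<le> 1"
    "n - card U \<le> card {i. i < n \<and> \<bar>x i\<bar> = 1}" "\<forall>u\<in>U. dot n u x = 0" by blast
  let ?F = "{i. i < n \<and> \<bar>x i\<bar> = 1}"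
  have "real n / 2 \<le> real (card ?F)" using x(2) k by linarith
  also have "\<dots> = (\<Sum>i\<in>?F. \<bar>x i\<bar> * \<bar>x i\<bar>)"
    by simp
  also have "\<dots> = (\<Sum>i\<in>?F. x i * x i)"
    by (simp only: abs_mult_self_eq)
  also have "\<dots> \<le> dot n x x"
    unfolding dot_def by (intro sum_mono2) auto
  finally show ?thesis using x by blast
qed

section \<open>Matrices that the queries cannot tell apart\<close>

lemma history_cong:
  assumes "\<And>s. s < t \<Longrightarrow> mat_vec n d B (snd (query (history query n d A s))) = mat_vec n d A (snd (query (history query n d A s)))
     \<and> vec_mat n d (fst (query (history query n d A s))) B = vec_mat n d (fst (query (history query n d A s))) A"
  shows "s \<le> t \<Longrightarrow> history query n d B s = history query n d A s"
proof (induction s)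
  case (Suc s)
  \<comment> \<open>Equal histories produce equal queries, so it is enough to compare the answers
    along the run against \<open>A\<close>.\<close>
  then show ?case using assms[of s] by (auto simp: Let_def split: prod.splits)
qed simp

lemma mat_vec_add_rank1:
  assumes "dot d v w = 0"
  shows "mat_vec n d (\<lambda>i j. A i j + u i * v j) w = mat_vec n d A w"
proof -
  have "(\<Sum>j<d. (A i j + u i * v j) * w j) = (\<Sum>j<d. A i j * w j) + u i * dot d v w" for i
    by (simp add: dot_def sum.distrib sum_distrib_left algebra_simps)
  then show ?thesis using assms by (intro ext) (simp add: mat_vec_def)
qed

lemma vec_mat_add_rank1:
  assumes "dot n p u = 0"
  shows "vec_mat n d p (\<lambda>i j. A i j + u i * v j) = vec_mat n d p A"
proof -
  have "(\<Sum>i<n. p i * (A i j + u i * v j)) = (\<Sum>i<n. p i * A i j) + dot n p u * v j" for j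
    by (simp add: dot_def sum.distrib sum_distrib_left algebra_simps)
  then show ?thesis using assms by (intro ext) (simp add: vec_mat_def)
qed

section \<open>Bounds on the margins\<close>

lemma bilin_eq_dot: "bilin n d p A w = dot n p (mat_vec n d A w)"
  by (simp add: bilin_def dot_def mat_vec_def sum_distrib_left mult.assoc)

text \<open>A real infimum is a lower bound only for a set bounded below. Here the 1-norm of
  \<open>A w\<close> gives the bound, as the entries of a point of the simplex lie between 0 and
  1.\<close>

lemma margin_le_bilin:
  assumes "p \<in> simplex n"
  shows "margin n d A w \<le> bilin n d p A w"
  unfolding margin_def
proof (intro cInf_lower bdd_belowI2)
  fix q assume q: "q \<in> simplex n"
  have "- (q i * mat_vec n d A w i) \<le> \<bar>mat_vec n d A w i\<bar>" if "i < n" for i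
  proof -
    have "0 \<le> q i" using q that by (simp add: simplex_def)
    moreover have "q i \<le> (\<Sum>i<n. q i)"
      using q that by (intro member_le_sum) (auto simp: simplex_def)
    ultimately have "\<bar>q i\<bar> \<le> 1" using q by (simp add: simplex_def)
    then have "\<bar>q i * mat_vec n d A w i\<bar> \<le> 1 * \<bar>mat_vec n d A w i\<bar>"
      unfolding abs_mult by (intro mult_right_mono) auto
    then show ?thesis by linarith
  qed
  then have "(\<Sum>i<n. - (q i * mat_vec n d A w i)) \<le> (\<Sum>i<n. \<bar>mat_vec n d A w i\<bar>)"
    by (intro sum_mono) auto
  then show "- (\<Sum>i<n. \<bar>mat_vec n d A w i\<bar>) \<le> bilin n d q A w"
    by (simp add: bilin_eq_dot dot_def sum_negf)
qed (use assms in auto)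

lemma unit_in_simplex: "0 < n \<Longrightarrow> (\<lambda>i. if i = 0 then 1 else 0) \<in> simplex n"
  by (auto simp: simplex_def)

lemma opt_margin_ge:
  assumes n: "0 < n" and A: "\<And>i j. i < n \<Longrightarrow> j < d \<Longrightarrow> \<bar>A i j\<bar> \<le> 1"
    and w: "w \<in> l1_ball d" and ge: "\<And>i. i < n \<Longrightarrow> r \<le> mat_vec n d A w i"
  shows "r \<le> opt_margin n d A"
proof -
  let ?e = "(\<lambda>i. if i = 0 then 1 else 0) :: vec"
  have "r \<le> bilin n d p A w" if p: "p \<in> simplex n" for p
  proof -
    have "r = (\<Sum>i<n. p i * r)" using p by (simp add: simplex_def sum_distrib_right[symmetric])
    also have "\<dots> \<le> (\<Sum>i<n. p i * mat_vec n d A w i)"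
      using p ge by (intro sum_mono mult_left_mono) (auto simp: simplex_def)
    finally show ?thesis by (simp add: bilin_eq_dot dot_def)
  qed
  then have "r \<le> margin n d A w"
    unfolding margin_def using unit_in_simplex[OF n] by (intro cINF_greatest) auto
  also have "\<dots> \<le> opt_margin n d A"
    unfolding opt_margin_def
  proof (intro cSup_upper bdd_aboveI2)
    \<comment> \<open>The supremum needs an upper bound: the margin is at most the value in row 0,
      hence at most the 1-norm of \<open>v\<close>.\<close>
    fix v assume v: "v \<in> l1_ball d"
    have "margin n d A v \<le> bilin n d ?e A v"
      by (rule margin_le_bilin[OF unit_in_simplex[OF n]])
    also have "\<dots> = (\<Sum>i\<in>{0}. ?e i * mat_vec n d A v i)"
      unfolding bilin_eq_dot dot_def using n by (intro sum.mono_neutral_right) auto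
    also have "\<dots> = (\<Sum>j<d. A 0 j * v j)" using n by (simp add: mat_vec_def)
    also have "\<dots> \<le> (\<Sum>j<d. \<bar>v j\<bar>)"
    proof (intro sum_mono)
      fix j assume "j \<in> {..<d}"
      then have "\<bar>A 0 j * v j\<bar> \<le> 1 * \<bar>v j\<bar>"
        unfolding abs_mult using A n by (intro mult_right_mono) auto
      then show "A 0 j * v j \<le> \<bar>v j\<bar>" by linarith
    qed
    also have "\<dots> \<le> 1" using v by (simp add: l1_ball_def)
    finally show "margin n d A v \<le> 1" .
  qed (use w in auto)
  finally show ?thesis .
qed

section \<open>The adversary's chain and its invariant\<close>

definition spread :: "nat \<Rightarrow> vec \<Rightarrow> bool" where
  "spread n x \<longleftrightarrow> (\<forall>i<n. \<bar>x i\<bar> \<le> 1) \<and> real n / 2 \<le> dot n x x"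

text \<open>The links fixed after \<open>t\<close> rounds. The closing term
  \<open>h\<^sub>t g\<^sub>t\<^sup>T\<close> is absent because \<open>g\<^sub>t\<close> is not
  chosen yet.\<close>

definition chain_mat :: "(nat \<Rightarrow> vec) \<Rightarrow> (nat \<Rightarrow> vec) \<Rightarrow> nat \<Rightarrow> mat" where
  "chain_mat h g t = (\<lambda>i j. \<Sum>k<t. (h k i - h (Suc k) i) * g k j)"

text \<open>The vector \<open>h\<^sub>k\<close> as a multiple of \<open>f\<^sub>k\<close>,
  normalised so that its inner product with \<open>f\<^sub>k\<close> is
  \<open>n / (8 T\<^sup>2)\<close> for \<open>k = 0\<close> and \<open>T\<close> times that for
  later \<open>k\<close>.\<close>

definition chain_vec :: "nat \<Rightarrow> nat \<Rightarrow> (nat \<Rightarrow> vec) \<Rightarrow> nat \<Rightarrow> vec" where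
  "chain_vec n T f k = (\<lambda>i. real n * (if k = 0 then 1 else real T) / (8 * (real T)\<^sup>2)
     / dot n (f k) (f k) * f k i)"

lemma dot_chain_vec: "dot n p (chain_vec n T f k) = real n * (if k = 0 then 1 else real T) / (8 * (real T)\<^sup>2)
     / dot n (f k) (f k) * dot n p (f k)"
  unfolding chain_vec_def by (rule dot_scale_right)

lemma chain_mat_Suc:
  "chain_mat h g (Suc t) = (\<lambda>i j. chain_mat h g t i j + (h t i - h (Suc t) i) * g t j)"
  by (simp add: chain_mat_def)

lemma chain_mat_cong:
  assumes "\<And>k. k \<le> t \<Longrightarrow> h k = h' k" "\<And>k. k < t \<Longrightarrow> g k = g' k"
  shows "chain_mat h g t = chain_mat h' g' t"
  unfolding chain_mat_def using assms by (intro ext sum.cong) auto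

text \<open>The invariant after \<open>t\<close> rounds. Rounds count from 0: query \<open>s\<close>
  is made when \<open>f\<^sub>0\<close>, ..., \<open>f\<^sub>s\<close> and \<open>g\<^sub>0\<close>,
  ..., \<open>g\<^sub>s\<^sub>-\<^sub>1\<close> are fixed, and everything chosen afterwards is
  orthogonal to it. The queries are those of the run against the unfinished chain.\<close>

definition resists :: "(response list \<Rightarrow> vec \<times> vec) \<Rightarrow> nat \<Rightarrow> nat \<Rightarrow> nat \<Rightarrow> (nat \<Rightarrow> vec) \<Rightarrow> (nat \<Rightarrow> vec) \<Rightarrow> nat \<Rightarrow> bool" where
  "resists query n d T f g t \<longleftrightarrow> f 0 = (\<lambda>_. 1) \<and>
     (\<forall>k\<le>t. spread n (f k) \<and> (\<forall>l<k. dot n (f l) (f k) = 0)) \<and>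
     (\<forall>k<t. spread d (g k) \<and> (\<forall>l<k. dot d (g l) (g k) = 0)) \<and>
     (\<forall>s<t. let (p, w) = query (history query n d (chain_mat (chain_vec n T f) g t) s)
        in (\<forall>k. s < k \<and> k \<le> t \<longrightarrow> dot n p (f k) = 0) \<and> (\<forall>k. s \<le> k \<and> k < t \<longrightarrow> dot d w (g k) = 0))"

text \<open>The next \<open>f\<close> and \<open>g\<close> are taken orthogonal to their
  predecessors and to all queries up to round \<open>t\<close>. The link added this way leaves the
  answers of the rounds before \<open>t\<close> unchanged, so those queries remain the ones actually
  made.\<close>

lemma resists_extend:
  assumes r: "resists query n d T f g t" and t: "t < T" and n: "4 * T \<le> n" and d: "4 * T \<le> d"
  shows "\<exists>f g. resists query n d T f g (Suc t)"
proof -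
  define M where "M = chain_mat (chain_vec n T f) g t"
  define P where "P s = fst (query (history query n d M s))" for s
  define W where "W s = snd (query (history query n d M s))" for s
  have f0: "f 0 = (\<lambda>_. 1)" and f: "\<And>k. k \<le> t \<Longrightarrow> spread n (f k)"
    "\<And>k l. k \<le> t \<Longrightarrow> l < k \<Longrightarrow> dot n (f l) (f k) = 0"
    and g: "\<And>k. k < t \<Longrightarrow> spread d (g k)" "\<And>k l. k < t \<Longrightarrow> l < k \<Longrightarrow> dot d (g l) (g k) = 0"
    and Pf: "\<And>s k. s < k \<Longrightarrow> k \<le> t \<Longrightarrow> dot n (P s) (f k) = 0"
    and Wg: "\<And>s k. s \<le> k \<Longrightarrow> k < t \<Longrightarrow> dot d (W s) (g k) = 0"
    using r unfolding resists_def P_def W_def M_def by (auto simp: Let_def split_beta)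
  \<comment> \<open>Each set has at most \<open>2 * T\<close> elements, whence the bounds
    \<open>4 * T\<close> on \<open>n\<close> and \<open>d\<close>.\<close>
  let ?U = "f ` {..t} \<union> P ` {..t}" and ?V = "g ` {..<t} \<union> W ` {..t}"
  have "card ?U \<le> card (f ` {..t}) + card (P ` {..t})" by (rule card_Un_le)
  also have "\<dots> \<le> card {..t} + card {..t}" by (intro add_mono card_image_le) auto
  finally have "2 * card ?U \<le> n" using t n by simp
  then obtain x where x: "spread n x" "\<forall>u\<in>?U. dot n u x = 0"
    using exists_spread_orthogonal[of ?U n] unfolding spread_def by auto
  have "card ?V \<le> card (g ` {..<t}) + card (W ` {..t})" by (rule card_Un_le)
  also have "\<dots> \<le> card {..<t} + card {..t}" by (intro add_mono card_image_le) auto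
  finally have "2 * card ?V \<le> d" using t d by simp
  then obtain y where y: "spread d y" "\<forall>u\<in>?V. dot d u y = 0"
    using exists_spread_orthogonal[of ?V d] unfolding spread_def by auto
  define f' where "f' = f(Suc t := x)"
  define g' where "g' = g(t := y)"
  let ?h = "chain_vec n T f'"
  define u where "u i = ?h t i - ?h (Suc t) i" for i
  define M' where "M' = chain_mat ?h g' (Suc t)"
  have "chain_mat ?h g' t = M"
    unfolding M_def by (intro chain_mat_cong) (auto simp: chain_vec_def f'_def g'_def)
  then have M': "M' = (\<lambda>i j. M i j + u i * y j)"
    unfolding M'_def chain_mat_Suc u_def by (simp add: g'_def)
  have Pf': "dot n (P s) (f' k) = 0" if "s < k" "k \<le> Suc t" for s k
    using that x Pf by (auto simp: f'_def)
  have Wg': "dot d (W s) (g' k) = 0" if "s \<le> k" "k < Suc t" for s k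
    using that y Wg by (auto simp: g'_def less_Suc_eq)
  \<comment> \<open>Round \<open>t\<close> itself is left out: \<open>P t\<close> need not be
    orthogonal to \<open>f t\<close>, so its answer may change. The history up to \<open>t\<close>
    involves earlier answers only.\<close>
  have "mat_vec n d M' (W s) = mat_vec n d M (W s) \<and> vec_mat n d (P s) M' = vec_mat n d (P s) M"
    if "s < t" for s
  proof
    show "mat_vec n d M' (W s) = mat_vec n d M (W s)"
      unfolding M' using y that by (intro mat_vec_add_rank1) (auto simp: dot_commute[of d y])
    have "dot n (P s) u = dot n (P s) (?h t) - dot n (P s) (?h (Suc t))"
      by (simp add: u_def dot_def right_diff_distrib sum_subtractf)
    also have "\<dots> = 0" using that by (simp add: dot_chain_vec Pf')
    finally show "vec_mat n d (P s) M' = vec_mat n d (P s) M"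
      unfolding M' by (intro vec_mat_add_rank1)
  qed
  then have H: "history query n d M' s = history query n d M s" if "s \<le> t" for s
    using that unfolding P_def W_def by (rule history_cong)
  have "resists query n d T f' g' (Suc t)"
    unfolding resists_def M'_def[symmetric]
  proof (intro conjI allI impI)
    fix k assume k: "k \<le> Suc t"
    show "spread n (f' k)" using k f(1) x by (auto simp: f'_def le_Suc_eq)
    fix l assume "l < k"
    then show "dot n (f' l) (f' k) = 0" using k f(2) x by (auto simp: f'_def le_Suc_eq)
  next
    fix k assume k: "k < Suc t"
    show "spread d (g' k)" using k g(1) y by (auto simp: g'_def less_Suc_eq)
    fix l assume "l < k"
    then show "dot d (g' l) (g' k) = 0" using k g(2) y by (auto simp: g'_def less_Suc_eq)
  next
    fix s assume "s < Suc t"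
    then show "let (p, w) = query (history query n d M' s)
        in (\<forall>k. s < k \<and> k \<le> Suc t \<longrightarrow> dot n p (f' k) = 0) \<and> (\<forall>k. s \<le> k \<and> k < Suc t \<longrightarrow> dot d w (g' k) = 0)"
      using Pf' Wg' H[of s] by (auto simp: Let_def split_beta P_def W_def)
  qed (use f0 in \<open>auto simp: f'_def\<close>)
  then show ?thesis by blast
qed

lemma exists_resists:
  assumes "t \<le> T" "4 * T \<le> n" "4 * T \<le> d"
  shows "\<exists>f g. resists query n d T f g t"
  using assms(1)
proof (induction t)
  case 0
  show ?case
    by (intro exI[of _ "\<lambda>_ _. 1"]) (auto simp: resists_def spread_def dot_def)
next
  case (Suc t)
  then show ?case using resists_extend[of query n d T _ _ t] assms by auto
qed

section \<open>The completed chain: its optimum and the algorithm's output\<close>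

lemma l1_norm_spread_combination:
  assumes d: "0 < d" and g: "\<And>k. k \<le> T \<Longrightarrow> spread d (g k)"
    and orth: "\<And>k l. k \<le> T \<Longrightarrow> l \<le> T \<Longrightarrow> k \<noteq> l \<Longrightarrow> dot d (g k) (g l) = 0"
    and w: "w = (\<lambda>j. \<Sum>k\<le>T. \<theta> / dot d (g k) (g k) * g k j)"
  shows "k \<le> T \<Longrightarrow> dot d (g k) w = \<theta>"
    and "(\<Sum>j<d. \<bar>w j\<bar>)\<^sup>2 \<le> 2 * (real T + 1) * \<theta>\<^sup>2"
proof -
  have pos: "real d / 2 \<le> dot d (g k) (g k)" "0 < dot d (g k) (g k)" if "k \<le> T" for k
    using g[OF that] d unfolding spread_def by auto
  show gw: "dot d (g k) w = \<theta>" if "k \<le> T" for k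
  proof -
    have "dot d (g k) w = (\<Sum>l\<le>T. \<theta> / dot d (g l) (g l) * dot d (g k) (g l))"
      unfolding w by (rule dot_sum_right)
    also have "\<dots> = (\<Sum>l\<in>{k}. \<theta> / dot d (g l) (g l) * dot d (g k) (g l))"
      using orth that by (intro sum.mono_neutral_right) auto
    also have "\<dots> = \<theta>" using pos(2)[OF that] by simp
    finally show ?thesis .
  qed
  \<comment> \<open>Cauchy-Schwarz costs a factor \<open>d\<close>, which cancels against the
    squared norms \<open>d / 2\<close> of the spread vectors.\<close>
  have "(\<Sum>j<d. \<bar>w j\<bar>)\<^sup>2 \<le> real d * (\<Sum>j<d. \<bar>w j\<bar>\<^sup>2)"
    using sum_squared_le_sum_of_squares[of "\<lambda>j. \<bar>w j\<bar>" "{..<d}"] by (simp add: mult.commute)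
  also have "(\<Sum>j<d. \<bar>w j\<bar>\<^sup>2) = dot d w w" by (simp add: dot_def power2_eq_square)
  also have "\<dots> = (\<Sum>k\<le>T. \<theta> / dot d (g k) (g k) * dot d w (g k))"
    by (subst (2) w) (rule dot_sum_right)
  also have "\<dots> = (\<Sum>k\<le>T. \<theta>\<^sup>2 / dot d (g k) (g k))"
    by (intro sum.cong) (simp_all add: dot_commute[of d w] gw power2_eq_square)
  also have "\<dots> \<le> (\<Sum>k\<le>T. \<theta>\<^sup>2 / (real d / 2))"
    using pos d by (intro sum_mono divide_left_mono mult_pos_pos) auto
  also have "real d * \<dots> = 2 * (real T + 1) * \<theta>\<^sup>2" using d by simp
  finally show "(\<Sum>j<d. \<bar>w j\<bar>)\<^sup>2 \<le> 2 * (real T + 1) * \<theta>\<^sup>2"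
    using d by (simp add: mult_left_mono)
qed

lemma mat_vec_chain_mat:
  assumes "i < n"
  shows "mat_vec n d (\<lambda>i j. chain_mat h g t i j + u i * v j) w i
    = (\<Sum>k<t. dot d (g k) w * (h k i - h (Suc k) i)) + u i * dot d v w"
proof -
  have "mat_vec n d (\<lambda>i j. chain_mat h g t i j + u i * v j) w i
     = dot d w (\<lambda>j. \<Sum>k<t. (h k i - h (Suc k) i) * g k j) + u i * dot d v w"
    using assms
    by (simp add: mat_vec_def chain_mat_def dot_def distrib_right sum.distrib
        sum_distrib_left[of "u i"] mult.assoc mult.commute[of "w _"])
  then show ?thesis unfolding dot_sum_right by (simp add: dot_commute[of d w] mult.commute)
qed

lemma exists_hard_matrix:
  fixes out :: "response list \<Rightarrow> vec"
  assumes T: "1 \<le> T" and n: "4 * T \<le> n" and d: "4 * T + 2 \<le> d"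
  shows "\<exists>A. (\<forall>i<n. \<forall>j<d. \<bar>A i j\<bar> \<le> 1) \<and>
    1 / (16 * (real T)\<^sup>2 * sqrt (real T)) \<le> opt_margin n d A \<and>
    margin n d A (out (history query n d A T)) \<le> 0"
proof -
  from exists_resists[of T T n d query] n d obtain f g0 where
    r: "resists query n d T f g0 T" by auto
  let ?h = "chain_vec n T f"
  define M where "M = chain_mat ?h g0 T"
  define P where "P s = fst (query (history query n d M s))" for s
  define W where "W s = snd (query (history query n d M s))" for s
  define v where "v = out (history query n d M T)"
  have f0: "f 0 = (\<lambda>_. 1)" and f: "\<And>k. k \<le> T \<Longrightarrow> spread n (f k)"
    "\<And>k l. k \<le> T \<Longrightarrow> l < k \<Longrightarrow> dot n (f l) (f k) = 0"
    and g0: "\<And>k. k < T \<Longrightarrow> spread d (g0 k)" "\<And>k l. k < T \<Longrightarrow> l < k \<Longrightarrow> dot d (g0 l) (g0 k) = 0"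
    and Pf: "\<And>s. s < T \<Longrightarrow> dot n (P s) (f T) = 0"
    using r unfolding resists_def P_def M_def by (auto simp: Let_def split_beta)
  \<comment> \<open>The last vector must avoid \<open>T\<close> earlier ones, \<open>T\<close>
    queries and the output: \<open>2 * T + 1\<close> constraints, whence
    \<open>4 * T + 2 \<le> d\<close>.\<close>
  let ?V = "insert v (g0 ` {..<T} \<union> W ` {..<T})"
  have "card ?V \<le> Suc (card (g0 ` {..<T} \<union> W ` {..<T}))" by (rule card_insert_le_m1) auto
  also have "\<dots> \<le> Suc (card (g0 ` {..<T}) + card (W ` {..<T}))" by (simp add: card_Un_le)
  also have "\<dots> \<le> Suc (card {..<T} + card {..<T})" by (intro Suc_le_mono[THEN iffD2] add_mono card_image_le) auto
  finally have "2 * card ?V \<le> d" using d by simp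
  then obtain z where z: "spread d z" "\<forall>u\<in>?V. dot d u z = 0"
    using exists_spread_orthogonal[of ?V d] unfolding spread_def by auto
  define g where "g = g0(T := z)"
  have g: "spread d (g k)" if "k \<le> T" for k using that g0(1) z by (auto simp: g_def)
  have g_less: "dot d (g l) (g k) = 0" if "k \<le> T" "l < k" for k l
    using that g0(2) z by (auto simp: g_def)
  then have g_orth: "dot d (g k) (g l) = 0" if "k \<le> T" "l \<le> T" "k \<noteq> l" for k l
    using that by (metis dot_commute nat_neq_iff)
  have f_orth: "dot n (f k) (f l) = 0" if "k \<le> T" "l \<le> T" "k \<noteq> l" for k l
    using that f(2) by (metis dot_commute nat_neq_iff)
  have npos: "0 < n" and dpos: "0 < d" using T n d by auto
  have a: "real n / 2 \<le> dot n (f k) (f k)" "0 < dot n (f k) (f k)" if "k \<le> T" for k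
    using f(1)[OF that] npos unfolding spread_def by auto
  have M: "M = chain_mat ?h g T" unfolding M_def by (rule chain_mat_cong) (auto simp: g_def)
  define A where "A = (\<lambda>i j. chain_mat ?h g T i j + ?h T i * g T j)"
  have gv: "dot d (g T) v = 0" using z by (simp add: g_def dot_commute[of d z])
  \<comment> \<open>The closing term is invisible in all \<open>T\<close> rounds, so
    \<open>v\<close>, computed from the unfinished chain, is also the output against
    \<open>A\<close>.\<close>
  have "mat_vec n d A (W s) = mat_vec n d M (W s) \<and> vec_mat n d (P s) A = vec_mat n d (P s) M"
    if "s < T" for s
    unfolding A_def M[symmetric] using that z Pf
    by (intro conjI mat_vec_add_rank1 vec_mat_add_rank1)
      (auto simp: g_def dot_commute[of d z] dot_chain_vec)
  then have "history query n d A T = history query n d M T"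
    unfolding P_def W_def by (rule history_cong) auto
  then have out_eq: "out (history query n d A T) = v" by (simp add: v_def)

  have h0: "?h 0 i = 1 / (8 * (real T)\<^sup>2)" for i
    using npos by (simp add: chain_vec_def f0 dot_def)
  have h_le: "\<bar>?h k i\<bar> \<le> 1 / (4 * real T)" if "k \<le> T" "i < n" for k i
  proof -
    have "\<bar>f k i\<bar> \<le> 1" using f(1)[OF that(1)] that(2) by (simp add: spread_def)
    then have "\<bar>f k i\<bar> / dot n (f k) (f k) \<le> 1 / (real n / 2)"
      using a[OF that(1)] npos by (intro frac_le) auto
    moreover have "(if k = 0 then 1 else real T) \<le> real T" using T by simp
    ultimately have "(real n / (8 * (real T)\<^sup>2) * (if k = 0 then 1 else real T)) * (\<bar>f k i\<bar> / dot n (f k) (f k))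
       \<le> (real n / (8 * (real T)\<^sup>2) * real T) * (1 / (real n / 2))"
      using a[OF that(1)] by (intro mult_mono mult_left_mono) auto
    also have "\<dots> = 1 / (4 * real T)" using npos T by (simp add: power2_eq_square)
    finally show ?thesis using a(2)[OF that(1)] by (simp add: chain_vec_def abs_mult)
  qed
  \<comment> \<open>The \<open>T\<close> links contribute at most \<open>1 / (2 T)\<close> each and
    the closing term at most \<open>1 / (4 T)\<close>.\<close>
  have A_le: "\<bar>A i j\<bar> \<le> 1" if "i < n" "j < d" for i j
  proof -
    have gj: "\<bar>g k j\<bar> \<le> 1" if "k \<le> T" for k
      using g[OF that] \<open>j < d\<close> by (simp add: spread_def)
    have "\<bar>A i j\<bar> \<le> (\<Sum>k<T. \<bar>(?h k i - ?h (Suc k) i) * g k j\<bar>) + \<bar>?h T i * g T j\<bar>"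
      unfolding A_def chain_mat_def by (intro order_trans[OF abs_triangle_ineq] add_mono sum_abs) auto
    also have "\<dots> \<le> (\<Sum>k<T. 1 / (2 * real T)) + 1 / (4 * real T)"
    proof (intro add_mono sum_mono)
      fix k assume k: "k \<in> {..<T}"
      have "\<bar>?h k i - ?h (Suc k) i\<bar> \<le> \<bar>?h k i\<bar> + \<bar>?h (Suc k) i\<bar>" by (rule abs_triangle_ineq4)
      also have "\<dots> \<le> 1 / (4 * real T) + 1 / (4 * real T)"
        using k \<open>i < n\<close> by (intro add_mono h_le) auto
      also have "\<dots> = 1 / (2 * real T)" by simp
      finally have "\<bar>?h k i - ?h (Suc k) i\<bar> * \<bar>g k j\<bar> \<le> 1 / (2 * real T) * 1"
        using gj[of k] k by (intro mult_mono) auto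
      then show "\<bar>(?h k i - ?h (Suc k) i) * g k j\<bar> \<le> 1 / (2 * real T)" by (simp add: abs_mult)
    next
      have "\<bar>?h T i\<bar> * \<bar>g T j\<bar> \<le> 1 / (4 * real T) * 1"
        using gj[of T] h_le[of T i] \<open>i < n\<close> by (intro mult_mono) auto
      then show "\<bar>?h T i * g T j\<bar> \<le> 1 / (4 * real T)" by (simp add: abs_mult)
    qed
    also have "\<dots> \<le> 1" using T by (simp add: field_simps)
    finally show ?thesis .
  qed

  \<comment> \<open>This value turns the bound \<open>2 (T + 1) \<theta>\<^sup>2\<close> on the
    squared 1-norm into \<open>(T + 1) / (2 T)\<close>, which is at most 1.\<close>
  define \<theta> where "\<theta> = 1 / (2 * sqrt (real T))"
  define w0 where "w0 = (\<lambda>j. \<Sum>k\<le>T. \<theta> / dot d (g k) (g k) * g k j)"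
  define w where "w = (\<lambda>j. if j < d then w0 j else 0)"
  have w0: "k \<le> T \<Longrightarrow> dot d (g k) w0 = \<theta>" "(\<Sum>j<d. \<bar>w0 j\<bar>)\<^sup>2 \<le> 2 * (real T + 1) * \<theta>\<^sup>2" for k
    using l1_norm_spread_combination[OF dpos g g_orth w0_def] by auto
  have "\<theta>\<^sup>2 = 1 / (4 * real T)" by (simp add: \<theta>_def power_divide power_mult_distrib)
  then have "(\<Sum>j<d. \<bar>w0 j\<bar>)\<^sup>2 \<le> 2 * (real T + 1) * (1 / (4 * real T))" using w0(2) by simp
  also have "\<dots> \<le> 1\<^sup>2" using T by (simp add: field_simps)
  finally have "(\<Sum>j<d. \<bar>w0 j\<bar>) \<le> 1" by (rule power2_le_imp_le) simp
  then have w_ball: "w \<in> l1_ball d" by (simp add: l1_ball_def w_def)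
  have gw: "dot d (g k) w = \<theta>" if "k \<le> T" for k
    using w0(1)[of k] that by (simp add: w_def dot_def)
  have Aw: "mat_vec n d A w i = \<theta> / (8 * (real T)\<^sup>2)" if "i < n" for i
  proof -
    have "mat_vec n d A w i = (\<Sum>k<T. \<theta> * (?h k i - ?h (Suc k) i)) + ?h T i * \<theta>"
      unfolding A_def mat_vec_chain_mat[OF that] by (simp add: gw)
    also have "\<dots> = \<theta> * ?h 0 i"
      unfolding sum_distrib_left[symmetric] sum_lessThan_telescope'[of "\<lambda>k. ?h k i" T]
      by (simp add: algebra_simps)
    finally show ?thesis by (simp add: h0)
  qed
  have "1 / (16 * (real T)\<^sup>2 * sqrt (real T)) = \<theta> / (8 * (real T)\<^sup>2)" by (simp add: \<theta>_def)
  also have "\<dots> \<le> opt_margin n d A"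
    using opt_margin_ge[OF npos A_le w_ball] Aw by simp
  finally have opt: "1 / (16 * (real T)\<^sup>2 * sqrt (real T)) \<le> opt_margin n d A" .

  \<comment> \<open>The weights undo the scaling of the \<open>h\<^sub>k\<close>, so that
    \<open>q\<close> has the same inner product with each of them. The \<open>f\<^sub>0\<close> part
    of \<open>q\<close> is \<open>1 / n\<close> in every coordinate, and the other \<open>T\<close>
    terms, of size at most \<open>1 / (T n)\<close>, cannot make it negative.\<close>
  define c where "c k = (if k = 0 then 1 else 1 / real T) / real n" for k :: nat
  define q0 where "q0 = (\<lambda>i. \<Sum>k\<le>T. c k * f k i)"
  define q where "q = (\<lambda>i. if i < n then q0 i else 0)"
  have fq: "dot n (f k) q = c k * dot n (f k) (f k)" if "k \<le> T" for k
  proof -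
    have "dot n (f k) q = dot n (f k) q0" by (simp add: q_def dot_def)
    also have "\<dots> = (\<Sum>l\<le>T. c l * dot n (f k) (f l))" unfolding q0_def by (rule dot_sum_right)
    also have "\<dots> = (\<Sum>l\<in>{k}. c l * dot n (f k) (f l))"
      using f_orth that by (intro sum.mono_neutral_right) auto
    finally show ?thesis by simp
  qed
  have hq: "dot n q (?h k) = 1 / (8 * (real T)\<^sup>2)" if "k \<le> T" for k
    using a(2)[OF that] npos T by (simp add: dot_chain_vec dot_commute[of n q] fq that c_def)
  have "0 \<le> q0 i" if "i < n" for i
  proof -
    have "\<bar>\<Sum>k=1..T. c k * f k i\<bar> \<le> (\<Sum>k=1..T. \<bar>c k * f k i\<bar>)" by (rule sum_abs)
    also have "\<dots> \<le> (\<Sum>k=1..T. 1 / (real T * real n))"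
      using f(1) that by (intro sum_mono) (auto simp: c_def spread_def abs_mult divide_simps)
    also have "\<dots> = 1 / real n" using T by simp
    finally have "\<bar>\<Sum>k=1..T. c k * f k i\<bar> \<le> 1 / real n" .
    moreover have "q0 i = 1 / real n + (\<Sum>k=1..T. c k * f k i)"
      unfolding q0_def by (subst sum.atMost_shift) (simp add: c_def f0 sum.atLeast1_atMost_eq)
    ultimately show ?thesis by linarith
  qed
  moreover have "(\<Sum>i<n. q i) = 1"
    using fq[of 0] npos by (simp add: f0 dot_def c_def)
  ultimately have q: "q \<in> simplex n" by (auto simp: simplex_def q_def)
  \<comment> \<open>The closing term vanishes on \<open>v\<close>, and \<open>q\<close> annihilates
    every difference \<open>h\<^sub>k - h\<^sub>k\<^sub>+\<^sub>1\<close>.\<close>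
  have "bilin n d q A v = dot n q (\<lambda>i. \<Sum>k<T. dot d (g k) v * (?h k i - ?h (Suc k) i))"
    unfolding bilin_eq_dot unfolding dot_def[of n q] A_def
    by (intro sum.cong) (auto simp: mat_vec_chain_mat gv)
  also have "\<dots> = (\<Sum>k<T. dot d (g k) v * dot n q (\<lambda>i. ?h k i - ?h (Suc k) i))"
    by (rule dot_sum_right)
  also have "\<dots> = 0"
  proof (intro sum.neutral ballI)
    fix k assume k: "k \<in> {..<T}"
    have "dot n q (\<lambda>i. ?h k i - ?h (Suc k) i) = dot n q (?h k) - dot n q (?h (Suc k))"
      by (simp add: dot_def right_diff_distrib sum_subtractf)
    also have "\<dots> = 0" using k by (simp add: hq)
    finally show "dot d (g k) v * dot n q (\<lambda>i. ?h k i - ?h (Suc k) i) = 0" by simp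
  qed
  finally have "margin n d A v \<le> 0" using margin_le_bilin[OF q, of d A v] by simp
  then show ?thesis using A_le opt out_eq by auto
qed

section \<open>The universal constant and the logarithmic factors\<close>

theorem theorem3:
  shows "\<exists>c::real. c > 0 \<and>
    (\<forall>T n d :: nat. real T > c \<longrightarrow> real d > c * real T \<longrightarrow>
       real n > c * (real T)^2 * ln (real T) \<longrightarrow>
       (\<forall>(query :: response list \<Rightarrow> vec \<times> vec) (output :: response list \<Rightarrow> vec).
          \<exists>A :: mat. (\<forall>i<n. \<forall>j<d. \<bar>A i j\<bar> \<le> 1) \<and>
            opt_margin n d A \<ge> 1 / (c * ln (real d) * sqrt (ln (real n)))
                                 * (1 / ((real T)^2 * sqrt (real T))) \<and>
            margin n d A (output (history query n d A T)) \<le> 0))"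
proof (intro exI[of _ 16] conjI allI impI)
  fix T n d :: nat and query :: "response list \<Rightarrow> vec \<times> vec" and out :: "response list \<Rightarrow> vec"
  assume T: "16 < real T" and d: "16 * real T < real d"
    and n: "16 * (real T)^2 * ln (real T) < real n"
  have ln_ge_1: "1 \<le> ln x" if "3 \<le> x" for x :: real
    using that exp_le by (subst ln_ge_iff) auto
  \<comment> \<open>Reduces the assumption on \<open>n\<close> to the linear bound that
    \<open>exists_hard_matrix\<close> asks for.\<close>
  have "16 * real T * 1 \<le> 16 * real T * real T" using T by (intro mult_left_mono) auto
  also have "\<dots> \<le> 16 * (real T)^2 * ln (real T)"
    using mult_left_mono[OF ln_ge_1[of "real T"], of "16 * (real T)^2"] T
    by (simp add: power2_eq_square)
  finally have n': "16 * real T < real n" using n by simp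
  have "1 \<le> T" "4 * T \<le> n" "4 * T + 2 \<le> d" using T d n' by linarith+
  from exists_hard_matrix[OF this, of out query] obtain A where
    A: "\<forall>i<n. \<forall>j<d. \<bar>A i j\<bar> \<le> 1" "margin n d A (out (history query n d A T)) \<le> 0"
    and opt: "1 / (16 * (real T)\<^sup>2 * sqrt (real T)) \<le> opt_margin n d A" by blast
  \<comment> \<open>Both logarithms are at least 1, so dividing by them only lowers the bound
    \<open>1 / (16 T\<^sup>2 \<surd>T)\<close>, whose 16 is the constant chosen.\<close>
  have "1 \<le> ln (real d)" "1 \<le> ln (real n)" using T d n' by (auto intro!: ln_ge_1)
  then have "1 * 1 \<le> ln (real d) * sqrt (ln (real n))" by (intro mult_mono) auto
  then have "16 \<le> 16 * ln (real d) * sqrt (ln (real n))" by simp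
  then have "1 / (16 * ln (real d) * sqrt (ln (real n))) \<le> 1 / 16" by (intro divide_left_mono) auto
  then have "1 / (16 * ln (real d) * sqrt (ln (real n))) * (1 / ((real T)^2 * sqrt (real T)))
      \<le> 1 / 16 * (1 / ((real T)^2 * sqrt (real T)))"
    by (intro mult_right_mono) auto
  also have "\<dots> \<le> opt_margin n d A" using opt by (simp add: mult.assoc)
  finally show "\<exists>A :: mat. (\<forall>i<n. \<forall>j<d. \<bar>A i j\<bar> \<le> 1) \<and>
            opt_margin n d A \<ge> 1 / (16 * ln (real d) * sqrt (ln (real n)))
                                 * (1 / ((real T)^2 * sqrt (real T))) \<and>
            margin n d A (out (history query n d A T)) \<le> 0" using A by blast
qed simp

end
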